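(* Let $L$ be a Leibniz $n$-algebra over an infinite field and let $x=(x_2,\dots,x_n)\in L^{\times(n-1)}$ be a regular element for $L$ such that $x_2,\dots,x_n\in L_0(R(x_2,\dots,x_n))$. Then the Fitting null-component $L_0=L_0(R(x))$ of $L$ with respect to the operator $R(x)$ is a Cartan subalgebra of $L$.
   Context: A Leibniz $n$-algebra is a vector space $L$ with an $n$-linear multiplication $[-,\dots,-]$ satisfying $[[x_1,\dots,x_n],y_2,\dots,y_n]=\sum_{i=1}^n[x_1,\dots,x_{i-1},[x_i,y_2,\dots,y_n],x_{i+1},\dots,x_n]$. For $x=(x_2,\dots,x_n)\in L^{\times(n-1)}$ (the $(n-1)$-fold Cartesian power) the right multiplication operator is $R(x)=R(x_2,\dots,x_n):L\to L$, $R(x)(z)=[z,x_2,\dots,x_n]$. The Fitting null-component of $L$ with respect to $R(x)$ is $L_0(R(x))=\{v\in L: R(x)^i(v)=0\text{ for some } i\}$. An element $h\in L^{\times(n-1)}$ is regular for $L$ if the dimension of $L_0(R(h))$ is minimal (among all elements of $L^{\times(n-1)}$). For a subset $C$ of $L$, $N_1(C)=\{a\in L:[a,c_2,\dots,c_n]\in C\text{ for all }c_i\in C\}$. A Leibniz $n$-algebra $C$ is 1-nilpotent if the series $C^{<1>_1}=C$, $C^{<k+1>_1}=[C^{<k>_1},C,\dots,C]$ reaches $0$. A Cartan subalgebra of $L$ is a subalgebra $C$ that is 1-nilpotent and satisfies $C=N_1(C)$.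
   Formalization: L is assumed finite-dimensional; otherwise the claim fails: for L the direct sum over k of the strictly upper triangular k×k matrices (n=2), every x is regular with L_0(R(x))=L, but L is not 1-nilpotent. *)

theory Defs
  imports Complex_Main
begin

text \<open>The underlying space of the algebra is the whole type \<open>'v\<close>. The \<open>n\<close>-ary multiplication is a
  function on lists; only its values on lists of length \<open>n\<close> are constrained or used. An element
  \<open>(x\<^sub>2, \<dots>, x\<^sub>n)\<close> of the \<open>(n-1)\<close>-fold Cartesian power is a list of length \<open>n - 1\<close>. The assumption
  \<open>1 \<le> n\<close> only makes \<open>n - 1\<close> meaningful.\<close>

locale leibniz_n_algebra = vector_space scale
  for scale :: "'k::field \<Rightarrow> 'v::ab_group_add \<Rightarrow> 'v" +
  fixes n :: nat
    and br :: "'v list \<Rightarrow> 'v"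
  assumes n_pos: "1 \<le> n"
    and multilinear:
      "\<And>xs i. length xs = n \<Longrightarrow> i < n \<Longrightarrow> Vector_Spaces.linear scale scale (\<lambda>v. br (xs[i := v]))"
    and leibniz_identity:
      "\<And>xs ys. length xs = n \<Longrightarrow> length ys = n - 1 \<Longrightarrow>
         br (br xs # ys) = (\<Sum>i<n. br (xs[i := br (xs ! i # ys)]))"
begin

definition R :: "'v list \<Rightarrow> 'v \<Rightarrow> 'v" where
  "R x z = br (z # x)"

definition fitting_null :: "'v list \<Rightarrow> 'v set" where
  "fitting_null x = {v. \<exists>i. (R x ^^ i) v = 0}"

text \<open>The library's \<open>dim\<close> is the true dimension only for finite-dimensional subspaces, so this
  notion is meant for finite-dimensional algebras.\<close>

definition regular :: "'v list \<Rightarrow> bool" where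
  "regular h \<longleftrightarrow> length h = n - 1 \<and>
     (\<forall>h'. length h' = n - 1 \<longrightarrow> dim (fitting_null h) \<le> dim (fitting_null h'))"

definition subalgebra :: "'v set \<Rightarrow> bool" where
  "subalgebra C \<longleftrightarrow> subspace C \<and> (\<forall>xs. length xs = n \<and> set xs \<subseteq> C \<longrightarrow> br xs \<in> C)"

text \<open>\<open>bracket_span A C\<close> is the subspace \<open>[A, C, \<dots>, C]\<close>.\<close>

definition bracket_span :: "'v set \<Rightarrow> 'v set \<Rightarrow> 'v set" where
  "bracket_span A C = span {br (a # cs) | a cs. a \<in> A \<and> length cs = n - 1 \<and> set cs \<subseteq> C}"

text \<open>The index is shifted by one: \<open>series1 C k\<close> is \<open>C\<^bsup><k+1>\<^esup>\<close> (with subscript 1).\<close>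

primrec series1 :: "'v set \<Rightarrow> nat \<Rightarrow> 'v set" where
  "series1 C 0 = C"
| "series1 C (Suc k) = bracket_span (series1 C k) C"

definition one_nilpotent :: "'v set \<Rightarrow> bool" where
  "one_nilpotent C \<longleftrightarrow> (\<exists>k. series1 C k = {0})"

definition N1 :: "'v set \<Rightarrow> 'v set" where
  "N1 C = {a. \<forall>cs. length cs = n - 1 \<and> set cs \<subseteq> C \<longrightarrow> br (a # cs) \<in> C}"

definition cartan_subalgebra :: "'v set \<Rightarrow> bool" where
  "cartan_subalgebra C \<longleftrightarrow> subalgebra C \<and> one_nilpotent C \<and> C = N1 C"

end

end

theory Submission imports Defs "HOL-Computational_Algebra.Polynomial" begin

text \<open>Let \<open>L\<^sub>0\<close> be the Fitting null-component of \<open>R x\<close>. As \<open>R x\<close> is a derivation, \<open>L\<^sub>0\<close> is a subalgebra.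
  For a tuple \<open>c\<close> in \<open>L\<^sub>0\<close>, the operators \<open>R (y t)\<close> with \<open>y t = x + t (c - x)\<close> preserve \<open>L\<^sub>0\<close> and depend
  polynomially on \<open>t\<close>. The operator induced on \<open>L / L\<^sub>0\<close> is injective for \<open>t = 0\<close>, hence for all but
  finitely many \<open>t\<close>; regularity of \<open>x\<close> then forces the null-component of \<open>R (y t)\<close> to be \<open>L\<^sub>0\<close>. So
  \<open>R (y t)\<close> is nilpotent on \<open>L\<^sub>0\<close> for infinitely many \<open>t\<close>, therefore for all \<open>t\<close>, in particular for
  \<open>t = 1\<close>: each \<open>R c\<close> is nilpotent on \<open>L\<^sub>0\<close>, and an Engel theorem gives 1-nilpotency.

  For the Engel theorem, take a maximal set \<open>H\<close> of operators \<open>R c\<close> that acts nilpotently. It defines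
  a flag of \<open>L\<^sub>0\<close>; weigh a tuple by the flag levels of its entries. If \<open>H\<close> contains the operators of
  all tuples of larger weight than \<open>c\<close>, then \<open>[H, R c]\<close> lies in the span of \<open>H\<close>, so \<open>H\<close> together
  with \<open>R c\<close> still acts nilpotently and \<open>R c\<close> belongs to \<open>H\<close>.\<close>

section \<open>Induction on tuples weighted by levels\<close>

text \<open>Such a replacement lowers the total level of the tuple. The levels will be nilpotency
  degrees in one use and positions in a flag in the other.\<close>

lemma list_update_less_induct:
  fixes l :: "'a \<Rightarrow> nat"
  assumes step: "\<And>c. (\<And>i v. i < length c \<Longrightarrow> l v < l (c ! i) \<Longrightarrow> P (c[i := v])) \<Longrightarrow> P c"
  shows "P c"
proof (induction "sum_list (map l c)" arbitrary: c rule: less_induct)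
  case less
  show ?case
  proof (rule step)
    fix i v
    assume i: "i < length c" and v: "l v < l (c ! i)"
    have "sum_list (map l (c[i := v])) < sum_list (map l c)"
      using i v member_le_sum_list[of "l (c ! i)" "map l c"]
      by (simp add: map_update sum_list_update)
    then show "P (c[i := v])" by (rule less)
  qed
qed

section \<open>Kernels of matrices with polynomial entries\<close>

text \<open>Full column rank at \<open>t0\<close> makes some maximal minor a nonzero polynomial,
  which has finitely many roots. Elimination column by column replaces determinants: every
  exceptional \<open>t\<close> is a root of one of the pivots.\<close>

lemma finite_poly_matrix_singular:
  fixes A :: "'i \<Rightarrow> 'j \<Rightarrow> 'k::field poly"
  assumes "finite J"
    and "\<And>c. (\<And>i. i \<in> I \<Longrightarrow> (\<Sum>j\<in>J. poly (A i j) t0 * c j) = 0) \<Longrightarrow> \<forall>j\<in>J. c j = 0"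
  shows "finite {t. \<exists>c. (\<forall>i\<in>I. (\<Sum>j\<in>J. poly (A i j) t * c j) = 0) \<and> (\<exists>j\<in>J. c j \<noteq> 0)}"
  using assms
proof (induction J arbitrary: A rule: finite_induct)
  case empty
  then show ?case by simp
next
  case (insert j0 J)
  \<comment> \<open>Otherwise the unit vector at \<open>j0\<close> would be a kernel vector at
    \<open>t0\<close>.\<close>
  have "\<exists>i0\<in>I. poly (A i0 j0) t0 \<noteq> 0"
  proof (rule ccontr)
    assume *: "\<not> ?thesis"
    have "(\<Sum>j\<in>insert j0 J. poly (A i j) t0 * (if j = j0 then 1 else 0)) = 0" if "i \<in> I" for i
      using * that by (intro sum.neutral) auto
    from insert.prems[OF this] show False by auto
  qed
  \<comment> \<open>One step of fraction-free Gaussian elimination with pivot \<open>A i0 j0\<close>.\<close>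
  then obtain i0 where i0: "i0 \<in> I" "poly (A i0 j0) t0 \<noteq> 0" by blast
  define p where "p = A i0 j0"
  define B where "B i j = p * A i j - A i j0 * A i0 j" for i j
  have sumB: "(\<Sum>j\<in>J. poly (B i j) t * c j)
      = poly p t * (\<Sum>j\<in>J. poly (A i j) t * c j) - poly (A i j0) t * (\<Sum>j\<in>J. poly (A i0 j) t * c j)"
    for i t c
    by (simp add: B_def sum_subtractf sum_distrib_left algebra_simps)
  have "\<forall>j\<in>J. c j = 0" if "\<And>i. i \<in> I \<Longrightarrow> (\<Sum>j\<in>J. poly (B i j) t0 * c j) = 0" for c
  proof -
    \<comment> \<open>A kernel vector of \<open>B\<close> at \<open>t0\<close> extends to one of
      \<open>A\<close>: the pivot row is solved for the entry at \<open>j0\<close>.\<close>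
    define c' where "c' j = (if j = j0 then - (\<Sum>j\<in>J. poly (A i0 j) t0 * c j) / poly p t0 else c j)" for j
    have c': "(\<Sum>j\<in>J. f j * c' j) = (\<Sum>j\<in>J. f j * c j)" for f :: "'j \<Rightarrow> 'k"
      using insert.hyps by (intro sum.cong) (auto simp: c'_def)
    have "(\<Sum>j\<in>insert j0 J. poly (A i j) t0 * c' j) = 0" if "i \<in> I" for i
    proof -
      have "poly p t0 * (\<Sum>j\<in>insert j0 J. poly (A i j) t0 * c' j)
          = poly (A i j0) t0 * (poly p t0 * c' j0) + poly p t0 * (\<Sum>j\<in>J. poly (A i j) t0 * c j)"
        using insert.hyps by (simp add: c' distrib_left mult.left_commute)
      also have "poly p t0 * c' j0 = - (\<Sum>j\<in>J. poly (A i0 j) t0 * c j)"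
        using i0 by (simp add: c'_def p_def)
      also have "poly (A i j0) t0 * \<dots> + poly p t0 * (\<Sum>j\<in>J. poly (A i j) t0 * c j) = 0"
        using sumB[of i t0 c] \<open>\<And>i. i \<in> I \<Longrightarrow> (\<Sum>j\<in>J. poly (B i j) t0 * c j) = 0\<close>[OF \<open>i \<in> I\<close>]
        by simp
      finally show ?thesis using i0 by (simp add: p_def)
    qed
    from insert.prems[OF this] insert.hyps show ?thesis by (auto simp: c'_def split: if_splits)
  qed
  from insert.IH[OF this]
  have fin: "finite {t. \<exists>c. (\<forall>i\<in>I. (\<Sum>j\<in>J. poly (B i j) t * c j) = 0) \<and> (\<exists>j\<in>J. c j \<noteq> 0)}" .
  have "finite {t. poly p t = 0}"
    using i0 by (intro poly_roots_finite) (auto simp: p_def)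
  moreover have "{t. \<exists>c. (\<forall>i\<in>I. (\<Sum>j\<in>insert j0 J. poly (A i j) t * c j) = 0) \<and> (\<exists>j\<in>insert j0 J. c j \<noteq> 0)}
    \<subseteq> {t. \<exists>c. (\<forall>i\<in>I. (\<Sum>j\<in>J. poly (B i j) t * c j) = 0) \<and> (\<exists>j\<in>J. c j \<noteq> 0)} \<union> {t. poly p t = 0}"
    (is "?L \<subseteq> ?R")
  proof
    fix t assume "t \<in> ?L"
    then obtain c j where c: "\<forall>i\<in>I. (\<Sum>j\<in>insert j0 J. poly (A i j) t * c j) = 0"
      and j: "j \<in> insert j0 J" "c j \<noteq> 0" by blast
    have eq: "(\<Sum>j\<in>J. poly (A i j) t * c j) = - poly (A i j0) t * c j0" if "i \<in> I" for i
      using c[rule_format, OF that] insert.hyps by (simp add: eq_neg_iff_add_eq_0 add.commute)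
    have "(\<Sum>j\<in>J. poly (B i j) t * c j) = 0" if "i \<in> I" for i
      using that i0 by (simp add: sumB eq p_def)
    \<comment> \<open>Where the pivot is nonzero, row \<open>i0\<close> determines
      \<open>c j0\<close> from the other entries, so these cannot all vanish.\<close>
    moreover have "\<exists>j\<in>J. c j \<noteq> 0" if "poly p t \<noteq> 0"
    proof (rule ccontr)
      assume *: "\<not> ?thesis"
      then have "poly p t * c j0 = 0" using eq[OF i0(1)] by (simp add: p_def)
      then show False using that * j by auto
    qed
    ultimately show "t \<in> ?R"
      by blast
  qed
  ultimately show ?case using fin by (meson finite_Un finite_subset)
qed

text \<open>A locale of its own, because the library interprets \<open>vector_space\<close> and
  \<open>finite_dimensional_vector_space\<close> globally without a mandatory qualifier: new names added to these
  locales are shadowed by their instances over the reals.\<close>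

locale finite_dim_space = finite_dimensional_vector_space scale Basis
  for scale :: "'a::field \<Rightarrow> 'b::ab_group_add \<Rightarrow> 'b" and Basis :: "'b set"
begin

section \<open>Descending series of a set of operators\<close>

text \<open>For linear operators and a subspace \<open>C\<close> this is the span of all products of
  \<open>k\<close> operators from \<open>H\<close> applied to \<open>C\<close>; \<open>H\<close>
  acts nilpotently on \<open>C\<close> when some term is zero.\<close>

primrec prod_series :: "('b \<Rightarrow> 'b) set \<Rightarrow> 'b set \<Rightarrow> nat \<Rightarrow> 'b set" where
  "prod_series H C 0 = C"
| "prod_series H C (Suc k) = span {h v | h v. h \<in> H \<and> v \<in> prod_series H C k}"

lemma subspace_prod_series: "subspace C \<Longrightarrow> subspace (prod_series H C k)"
  by (cases k) auto

lemma prod_series_SucI: "h \<in> H \<Longrightarrow> v \<in> prod_series H C k \<Longrightarrow> h v \<in> prod_series H C (Suc k)"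
  unfolding prod_series.simps by (rule span_base) blast

lemma prod_series_Suc_subset:
  assumes "subspace X" "\<And>h v. h \<in> H \<Longrightarrow> v \<in> prod_series H C k \<Longrightarrow> h v \<in> X"
  shows "prod_series H C (Suc k) \<subseteq> X"
  unfolding prod_series.simps using assms by (intro span_minimal) auto

lemma prod_series_mono:
  assumes "H \<subseteq> H'"
  shows "prod_series H C k \<subseteq> prod_series H' C k"
proof (induction k)
  case (Suc k)
  show ?case unfolding prod_series.simps using Suc assms by (intro span_mono) blast
qed simp

lemma prod_series_decreasing:
  assumes C: "subspace C" and inv: "\<And>h v. h \<in> H \<Longrightarrow> v \<in> C \<Longrightarrow> h v \<in> C"
  shows "prod_series H C (Suc k) \<subseteq> prod_series H C k"
proof (induction k)
  case 0
  show ?case using prod_series_Suc_subset[of C H C 0] C inv by simp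
next
  case (Suc k)
  then show ?case
    by (intro prod_series_Suc_subset[of "prod_series H C (Suc k)"] prod_series_SucI) auto
qed

lemma prod_series_antimono:
  assumes "subspace C" "\<And>h v. h \<in> H \<Longrightarrow> v \<in> C \<Longrightarrow> h v \<in> C" "i \<le> j"
  shows "prod_series H C j \<subseteq> prod_series H C i"
  using prod_series_decreasing[of C H] assms lift_Suc_antimono_le[of "prod_series H C" i j] by blast

text \<open>An element of the \<open>k\<close>-th term involves only finitely many operators, and
  these lie in a single member of the chain. This supplies the upper bounds for Zorn's
  lemma.\<close>

lemma prod_series_chain_Union:
  assumes C: "subspace C" and ne: "\<C> \<noteq> {}" and ch: "subset.chain \<A> \<C>"
    and v: "v \<in> prod_series (\<Union>\<C>) C k"
  shows "\<exists>H\<in>\<C>. v \<in> prod_series H C k"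
  using v
proof (induction k arbitrary: v)
  case 0
  then show ?case using ne by auto
next
  case (Suc k)
  \<comment> \<open>A directed union of subspaces is a subspace, so it suffices to treat the
    generators.\<close>
  define X where "X = (\<Union>H\<in>\<C>. prod_series H C (Suc k))"
  have X: "x \<in> X \<longleftrightarrow> (\<exists>H\<in>\<C>. x \<in> prod_series H C (Suc k))" for x
    unfolding X_def by (rule UN_iff)
  note P = subspace_prod_series[OF C, of _ "Suc k"]
  have comparable: "H \<subseteq> H' \<or> H' \<subseteq> H" if "H \<in> \<C>" "H' \<in> \<C>" for H H'
    using ch that by (auto simp: subset_chain_def)
  have "subspace X"
  proof (rule subspaceI)
    show "0 \<in> X" unfolding X using ne subspace_0[OF P] by blast
    fix x y c assume "x \<in> X"
    then obtain H where H: "H \<in> \<C>" "x \<in> prod_series H C (Suc k)" unfolding X by blast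
    then show "scale c x \<in> X" unfolding X using subspace_scale[OF P] by (intro bexI)
    assume "y \<in> X"
    then obtain H' where H': "H' \<in> \<C>" "y \<in> prod_series H' C (Suc k)" unfolding X by blast
    from comparable[OF H(1) H'(1)]
    obtain H'' where "H'' \<in> \<C>" "x \<in> prod_series H'' C (Suc k)" "y \<in> prod_series H'' C (Suc k)"
    proof
      assume "H \<subseteq> H'"
      from prod_series_mono[OF this, of C "Suc k"] show thesis using H H' that[of H'] by blast
    next
      assume "H' \<subseteq> H"
      from prod_series_mono[OF this, of C "Suc k"] show thesis using H H' that[of H] by blast
    qed
    then show "x + y \<in> X" unfolding X using subspace_add[OF P] by (intro bexI)
  qed
  moreover have "h u \<in> X" if h: "h \<in> \<Union>\<C>" and u: "u \<in> prod_series (\<Union>\<C>) C k" for h u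
  proof -
    from Suc.IH[OF u] obtain H where H: "H \<in> \<C>" "u \<in> prod_series H C k" by (elim bexE)
    from h obtain H' where H': "H' \<in> \<C>" "h \<in> H'" by (elim UnionE)
    from comparable[OF H(1) H'(1)]
    obtain H'' where "H'' \<in> \<C>" "u \<in> prod_series H'' C k" "h \<in> H''"
    proof
      assume "H \<subseteq> H'"
      from prod_series_mono[OF this, of C k] show thesis using H H' that[of H'] by blast
    next
      assume "H' \<subseteq> H"
      then show thesis using H H' that[of H] by blast
    qed
    then show ?thesis unfolding X using prod_series_SucI by (intro bexI)
  qed
  ultimately have "prod_series (\<Union>\<C>) C (Suc k) \<subseteq> X" by (rule prod_series_Suc_subset)
  then show ?case using Suc.prems unfolding X[symmetric] by (rule subsetD)
qed

lemma linear_funpow: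
  assumes "Vector_Spaces.linear scale scale s"
  shows "Vector_Spaces.linear scale scale (s ^^ i)"
proof (induction i)
  case 0
  then show ?case by (simp add: linear_iff_module_hom module_hom_iff module_axioms)
next
  case (Suc i)
  then show ?case
    by (simp only: funpow_Suc_right) (rule Vector_Spaces.linear_compose[OF assms])
qed

text \<open>Modulo the next term of the series of \<open>H\<close>, every operator of
  \<open>H\<close> vanishes on the current term. Only powers of \<open>s\<close> survive there, and
  \<open>s ^^ m\<close> is zero, so \<open>m\<close> further factors lead one term deeper.\<close>

lemma prod_series_insert:
  assumes C: "subspace C"
    and inv: "\<And>h v. h \<in> insert s H \<Longrightarrow> v \<in> C \<Longrightarrow> h v \<in> C"
    and lin: "Vector_Spaces.linear scale scale s"
    and s: "\<And>v. v \<in> C \<Longrightarrow> (s ^^ m) v = 0"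
    and comm: "\<And>h v. h \<in> H \<Longrightarrow> v \<in> C \<Longrightarrow> s (h v) - h (s v) \<in> span {h' v | h'. h' \<in> H}"
  shows "\<exists>j. prod_series (insert s H) C j \<subseteq> prod_series H C k"
proof -
  let ?P = "prod_series H C" and ?Q = "prod_series (insert s H) C"
  note P = subspace_prod_series[OF C, of H]
  have P_dec: "?P (Suc k) \<subseteq> ?P k" for k
    using C inv by (intro prod_series_decreasing) auto
  have PC: "?P k \<subseteq> C" for k
    using prod_series_antimono[OF C, of H 0 k] inv by auto
  note lin' = linear_funpow[OF lin]
  have pre: "subspace {v. (s ^^ i) v \<in> X}" if "subspace X" for i X
    using module_hom.subspace_linear_preimage[of scale scale "s ^^ i" X] lin' that
    by (simp add: linear_iff_module_hom)
  \<comment> \<open>Moving \<open>s\<close> past \<open>h\<close> costs a combination of vectors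
    \<open>h' u\<close>, which lie in the same term as \<open>h u\<close>.\<close>
  have sP: "s v \<in> ?P k" if "v \<in> ?P k" for v k
    using that
  proof (induction k arbitrary: v)
    case 0
    then show ?case using inv by simp
  next
    case (Suc k)
    have "?P (Suc k) \<subseteq> {v. s v \<in> ?P (Suc k)}"
    proof (rule prod_series_Suc_subset, goal_cases)
      case 1
      then show ?case using pre[OF P, of 1 "Suc k"] by simp
    next
      case (2 h u)
      have "span {h' u | h'. h' \<in> H} \<subseteq> ?P (Suc k)"
        using 2 by (intro span_minimal P) (blast intro: prod_series_SucI)
      moreover have "h (s u) \<in> ?P (Suc k)"
        using 2 Suc.IH by (intro prod_series_SucI) auto
      ultimately have "(s (h u) - h (s u)) + h (s u) \<in> ?P (Suc k)"
        using comm[of h u] 2 PC by (intro subspace_add[OF P]) blast+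
      then show ?case by simp
    qed
    then show ?case using Suc.prems by blast
  qed
  have sP': "(s ^^ i) v \<in> ?P k" if "v \<in> ?P k" for v i k
    using that by (induction i) (auto intro: sP)
  show ?thesis
  proof (induction k)
    case 0
    show ?case by (rule exI[of _ 0]) simp
  next
    case (Suc k)
    then obtain j where j: "?Q j \<subseteq> ?P k" ..
    \<comment> \<open>After \<open>i\<close> factors, \<open>m - i\<close> more applications of
      \<open>s\<close> reach the next term: a factor \<open>s\<close> uses up one of them, while a
      factor from \<open>H\<close> lands there at once and \<open>s\<close> does not lead out
      again.\<close>
    have "?Q (j + i) \<subseteq> ?P k \<inter> {v. (s ^^ (m - i)) v \<in> ?P (Suc k)}" if "i \<le> m" for i
      using that
    proof (induction i)
      case 0
      then show ?case using j s PC subspace_0[OF P[of "Suc k"]] by (auto simp del: prod_series.simps) (metis subsetD)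
    next
      case (Suc i)
      show ?case unfolding add_Suc_right
      proof (rule prod_series_Suc_subset, goal_cases)
        case 1
        show ?case by (intro subspace_inter P pre)
      next
        case (2 h v)
        with Suc have v: "v \<in> ?P k" "(s ^^ (m - i)) v \<in> ?P (Suc k)" by auto
        from 2 consider "h = s" | "h \<in> H" by blast
        then show ?case
        proof cases
          case 1
          have "m - i = Suc (m - Suc i)" using Suc.prems by simp
          then have "(s ^^ (m - Suc i)) (s v) \<in> ?P (Suc k)"
            using v(2) by (simp add: funpow_swap1 del: prod_series.simps)
          then show ?thesis using 1 v sP by (simp del: prod_series.simps)
        next
          case 2
          then have "h v \<in> ?P (Suc k)" using v by (intro prod_series_SucI)
          then show ?thesis using P_dec[of k] sP' by (auto simp del: prod_series.simps)
        qed
      qed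
    qed
    from this[of m] show ?case by (intro exI[of _ "j + m"]) (auto simp del: prod_series.simps)
  qed
qed

section \<open>Polynomial dependence on a scalar\<close>

text \<open>These are the polynomials in \<open>t\<close> with vector coefficients. The inductive
  form lets multilinearity be applied rule by rule.\<close>

inductive polymap :: "('a \<Rightarrow> 'b) \<Rightarrow> bool" where
  const: "polymap (\<lambda>t. a)"
| add: "polymap f \<Longrightarrow> polymap g \<Longrightarrow> polymap (\<lambda>t. f t + g t)"
| scale: "polymap f \<Longrightarrow> polymap (\<lambda>t. scale t (f t))"

lemma polymap_representation:
  assumes "polymap f" "independent B" "span B = UNIV"
  shows "\<exists>p. \<forall>t. representation B (f t) b = poly p t"
  using assms(1)
proof induction
  case (const a)
  show ?case by (rule exI[of _ "[:representation B a b:]"]) simp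
next
  case (add f g)
  then obtain p q where "\<forall>t. representation B (f t) b = poly p t" "\<forall>t. representation B (g t) b = poly q t"
    by blast
  then show ?case using assms(2,3) by (intro exI[of _ "p + q"]) (simp add: representation_add)
next
  case (scale f)
  then obtain p where "\<forall>t. representation B (f t) b = poly p t" by blast
  then show ?case using assms(2,3) by (intro exI[of _ "pCons 0 p"]) (simp add: representation_scale)
qed

text \<open>Every coordinate in a basis is a polynomial in \<open>t\<close> with infinitely many
  roots.\<close>

lemma polymap_eq_0:
  assumes f: "polymap f" and inf: "infinite {t. f t = 0}"
  shows "f t = 0"
proof -
  obtain B where B: "independent B" "span B = UNIV"
    by (metis independent_empty independent_extend_basis span_extend_basis)
  have "representation B (f t) b = 0" for b
  proof -
    obtain p where p: "\<And>t. representation B (f t) b = poly p t"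
      using polymap_representation[OF f B] by blast
    have "{t. f t = 0} \<subseteq> {t. poly p t = 0}"
      by (auto simp: p[symmetric] representation_zero)
    then have "p = 0" using inf poly_roots_finite finite_subset by blast
    then show ?thesis by (simp add: p)
  qed
  then show ?thesis using sum_nonzero_representation_eq[OF B(1), of "f t"] B(2) by simp
qed

section \<open>Uniform exponents from the dimension\<close>

text \<open>Once two consecutive terms agree the series is constant, so each step before zero loses
  a dimension. The bound does not depend on \<open>H\<close>.\<close>

lemma prod_series_dim:
  assumes C: "subspace C" and inv: "\<And>h v. h \<in> H \<Longrightarrow> v \<in> C \<Longrightarrow> h v \<in> C"
    and k: "prod_series H C k \<subseteq> {0}"
  shows "prod_series H C (dim C) \<subseteq> {0}"
proof (rule ccontr)
  let ?P = "prod_series H C"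
  assume nz: "\<not> ?P (dim C) \<subseteq> {0}"
  note P = subspace_prod_series[OF C, of H]
  have "?P (Suc i) \<subset> ?P i" if i: "i \<le> dim C" for i
  proof (rule ccontr)
    assume "\<not> ?thesis"
    then have eq: "?P (Suc i) = ?P i" using prod_series_decreasing[of C H i] C inv by blast
    have const: "?P (i + j) = ?P i" for j
    proof (induction j)
      case (Suc j)
      then show ?case using eq by simp
    qed simp
    then have "?P i \<subseteq> ?P k"
      using prod_series_antimono[of C H k "i + k"] const[of k] C inv by auto
    then show False
      using nz k prod_series_antimono[of C H i "dim C"] C inv i by blast
  qed
  then have less: "dim (?P (Suc i)) < dim (?P i)" if "i \<le> dim C" for i
    using that span_eq_iff P by (intro dim_psubset) (metis psubset_eq)
  have "dim (?P i) + i \<le> dim C" if "i \<le> Suc (dim C)" for i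
    using that
  proof (induction i)
    case (Suc i)
    then show ?case using less[of i] by simp
  qed simp
  from this[of "Suc (dim C)"] show False by simp
qed

text \<open>The kernel of \<open>T ^^ i\<close> is stable under \<open>T\<close>, which acts
  nilpotently on it, so the dimension bound applies to the series of \<open>{T}\<close>
  there.\<close>

lemma nilpotent_funpow_dim:
  assumes lin: "Vector_Spaces.linear scale scale T" and v: "(T ^^ i) v = 0" and d: "dimension \<le> d"
  shows "(T ^^ d) v = 0"
proof -
  define K where "K j = {v. (T ^^ j) v = 0}" for j
  note lin' = linear_funpow[OF lin]
  have K: "subspace (K j)" for j
    using module_hom.subspace_kernel[of scale scale "T ^^ j"] lin'
    by (simp add: linear_iff_module_hom K_def)
  have T0: "T 0 = 0"
    using lin module_hom.zero by (auto simp: linear_iff_module_hom)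
  have inv: "h v \<in> K i" if "h \<in> {T}" "v \<in> K i" for h v
    using that T0 by (simp add: K_def flip: funpow_swap1)
  \<comment> \<open>The series descends through the kernels of lower powers and ends in
    \<open>K 0\<close>, which is zero.\<close>
  have "prod_series {T} (K i) j \<subseteq> K (i - j)" if "j \<le> i" for j
    using that
  proof (induction j)
    case (Suc j)
    then have "i - j = Suc (i - Suc j)" by simp
    with Suc show ?case
      by (intro prod_series_Suc_subset K) (auto simp: K_def funpow_swap1)
  qed simp
  from this[of i] have "prod_series {T} (K i) i \<subseteq> {0}" by (auto simp: K_def)
  then have P: "prod_series {T} (K i) (dim (K i)) \<subseteq> {0}"
    using prod_series_dim[of "K i" "{T}" i] K inv by blast
  have "(T ^^ j) v \<in> prod_series {T} (K i) j" for j
  proof (induction j)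
    case 0
    then show ?case using v by (simp add: K_def)
  next
    case (Suc j)
    then show ?case using prod_series_SucI[of T "{T}" "(T ^^ j) v"] by simp
  qed
  with P have "(T ^^ dim (K i)) v = 0" by auto
  moreover have "dim (K i) \<le> d" using d dim_subset_UNIV le_trans by blast
  then obtain e where "d = e + dim (K i)" by (metis add.commute le_Suc_ex)
  moreover have "(T ^^ e) 0 = 0" using T0 by (induction e) auto
  ultimately show ?thesis by (simp add: funpow_add)
qed

section \<open>Injectivity modulo an invariant subspace\<close>

text \<open>The operator that \<open>T t\<close> induces on the quotient by \<open>S\<close> is
  injective for \<open>t = t0\<close>, and its matrix is polynomial in \<open>t\<close>.
  Complementary basis vectors replace the quotient space.\<close>

lemma finite_polymap_singular_mod:
  fixes T :: "'a \<Rightarrow> 'b \<Rightarrow> 'b"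
  assumes S: "subspace S"
    and lin: "\<And>t. Vector_Spaces.linear scale scale (T t)"
    and inv: "\<And>t v. v \<in> S \<Longrightarrow> T t v \<in> S"
    and poly: "\<And>v. polymap (\<lambda>t. T t v)"
    and t0: "\<And>v. T t0 v \<in> S \<Longrightarrow> v \<in> S"
  shows "finite {t. \<exists>v. T t v \<in> S \<and> v \<notin> S}"
proof -
  obtain C where C: "C \<subseteq> S" "independent C" "span C = S"
    using maximal_independent_subset[of S] S span_subspace by metis
  define B where "B = extend_basis C"
  have B: "C \<subseteq> B" "independent B" "span B = UNIV"
    unfolding B_def using C extend_basis_superset independent_extend_basis span_extend_basis by auto
  have finB: "finite B" using B finiteI_independent by blast
  \<comment> \<open>The classes of these vectors form a basis of the quotient by
    \<open>S\<close>.\<close>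
  define J where "J = B - C"
  define rep where "rep v b = representation B v b" for v b
  have rep_hom: "module_hom scale (*) (\<lambda>v. rep v b)" for b
    unfolding rep_def using linear_representation[OF B(2,3)] by (simp add: linear_iff_module_hom)
  have T_hom: "module_hom scale scale (T t)" for t
    using lin by (simp add: linear_iff_module_hom)
  have expand: "v = (\<Sum>b\<in>C. scale (rep v b) b) + (\<Sum>b\<in>J. scale (rep v b) b)" for v
  proof -
    have "v = (\<Sum>b\<in>B. scale (rep v b) b)"
      unfolding rep_def using B finB sum_representation_eq[of B v B] by simp
    then show ?thesis unfolding J_def
      using sum.subset_diff[OF B(1) finB, of "\<lambda>b. scale (rep v b) b"] by (simp add: add.commute)
  qed
  have CS: "(\<Sum>b\<in>C. scale (f b) b) \<in> S" for f
    using C S by (intro subspace_sum subspace_scale) auto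
  have S_iff: "v \<in> S \<longleftrightarrow> (\<forall>b\<in>J. rep v b = 0)" for v
  proof
    assume "v \<in> S"
    then have "rep v = representation C v"
      unfolding rep_def using C B by (intro representation_extend) auto
    then show "\<forall>b\<in>J. rep v b = 0"
      unfolding J_def using representation_ne_zero[of C v] by auto
  next
    assume "\<forall>b\<in>J. rep v b = 0"
    then have "v = (\<Sum>b\<in>C. scale (rep v b) b)" using expand[of v] by simp
    then show "v \<in> S" using CS by metis
  qed
  have rep_J: "rep (\<Sum>j\<in>J. scale (c j) j) b = c b" if "b \<in> J" for b c
  proof -
    have "rep (\<Sum>j\<in>J. scale (c j) j) b = (\<Sum>j\<in>J. c j * rep j b)"
      by (simp add: module_hom.sum[OF rep_hom] module_hom.scale[OF rep_hom])
    also have "\<dots> = (\<Sum>j\<in>J. if j = b then c j else 0)"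
      using B(2) by (intro sum.cong) (auto simp: rep_def J_def representation_basis)
    finally show ?thesis using that finB by (simp add: J_def)
  qed
  have "\<forall>i j. \<exists>p. \<forall>t. rep (T t j) i = poly p t"
    unfolding rep_def using polymap_representation[OF poly B(2,3)] by blast
  then obtain A where A: "\<And>i j t. rep (T t j) i = poly (A i j) t" by metis
  have T_J: "rep (T t (\<Sum>j\<in>J. scale (c j) j)) i = (\<Sum>j\<in>J. poly (A i j) t * c j)" for t c i
    by (simp add: module_hom.sum[OF rep_hom] module_hom.scale[OF rep_hom] module_hom.sum[OF T_hom]
        module_hom.scale[OF T_hom] mult.commute flip: A)
  have "finite J" using finB by (simp add: J_def)
  moreover have "\<forall>j\<in>J. c j = 0" if "\<And>i. i \<in> J \<Longrightarrow> (\<Sum>j\<in>J. poly (A i j) t0 * c j) = 0" for c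
  proof -
    have "T t0 (\<Sum>j\<in>J. scale (c j) j) \<in> S" unfolding S_iff T_J using that by blast
    then have "(\<Sum>j\<in>J. scale (c j) j) \<in> S" by (rule t0)
    then show ?thesis using S_iff rep_J by metis
  qed
  ultimately have "finite {t. \<exists>c. (\<forall>i\<in>J. (\<Sum>j\<in>J. poly (A i j) t * c j) = 0) \<and> (\<exists>j\<in>J. c j \<noteq> 0)}"
    by (rule finite_poly_matrix_singular)
  moreover have "\<exists>c. (\<forall>i\<in>J. (\<Sum>j\<in>J. poly (A i j) t * c j) = 0) \<and> (\<exists>j\<in>J. c j \<noteq> 0)"
    if v: "T t v \<in> S" "v \<notin> S" for t v
  proof (intro exI[of _ "rep v"] conjI ballI)
    show "\<exists>j\<in>J. rep v j \<noteq> 0" using v S_iff by blast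
    \<comment> \<open>Dropping the part \<open>?w\<close> of \<open>v\<close> in \<open>S\<close>
      changes \<open>T t v\<close> only by an element of \<open>S\<close>.\<close>
    let ?u = "\<Sum>j\<in>J. scale (rep v j) j" and ?w = "\<Sum>j\<in>C. scale (rep v j) j"
    have "T t ?u = T t v - T t ?w"
      using expand[of v] module_hom.add[OF T_hom, of t ?w ?u] by simp
    then have "T t ?u \<in> S" using S v CS inv by (simp add: subspace_diff)
    then show "(\<Sum>j\<in>J. poly (A i j) t * rep v j) = 0" if "i \<in> J" for i
      using that unfolding S_iff T_J by blast
  qed
  ultimately show ?thesis by (elim rev_finite_subset) blast
qed

end

section \<open>Right multiplications and the Fitting null-component\<close>

locale finite_dim_leibniz =
  leibniz_n_algebra scale n br + finite_dim_space scale Basis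
  for scale :: "'k::field \<Rightarrow> 'v::ab_group_add \<Rightarrow> 'v" and n br Basis
begin

lemma br_update_hom:
  "length xs = n \<Longrightarrow> i < n \<Longrightarrow> module_hom scale scale (\<lambda>v. br (xs[i := v]))"
  using multilinear by (simp add: linear_iff_module_hom)

lemma br_eq_0: "length xs = n \<Longrightarrow> i < n \<Longrightarrow> xs ! i = 0 \<Longrightarrow> br xs = 0"
  using module_hom.zero[OF br_update_hom, of xs i] list_update_id[of xs i] by simp

lemma linear_R:
  assumes "length c = n - 1"
  shows "Vector_Spaces.linear scale scale (R c)"
  using multilinear[of "0 # c" 0] assms n_pos by (simp add: R_def[abs_def])

lemma hom_R: "length c = n - 1 \<Longrightarrow> module_hom scale scale (R c)"
  using linear_R by (simp add: linear_iff_module_hom)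

lemma R_br:
  "length xs = n \<Longrightarrow> length c = n - 1 \<Longrightarrow> R c (br xs) = (\<Sum>i<n. br (xs[i := R c (xs ! i)]))"
  unfolding R_def by (rule leibniz_identity)

text \<open>This is the Leibniz identity for \<open>z # c\<close> with the slot of \<open>z\<close>
  split off. The commutator is a sum of right multiplications by tuples with one entry moved by
  \<open>R h\<close>.\<close>

lemma R_R:
  assumes "length h = n - 1" "length c = n - 1"
  shows "R h (R c z) = R c (R h z) + (\<Sum>i<n - 1. R (c[i := R h (c ! i)]) z)"
proof -
  obtain m where m: "n = Suc m" using n_pos by (cases n) auto
  show ?thesis
    using R_br[of "z # c" h] assms unfolding m sum.lessThan_Suc_shift by (simp add: R_def)
qed

lemma R_in_subalgebra:
  "subalgebra C \<Longrightarrow> length c = n - 1 \<Longrightarrow> set c \<subseteq> C \<Longrightarrow> v \<in> C \<Longrightarrow> R c v \<in> C"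
  using n_pos by (simp add: subalgebra_def R_def)

text \<open>A uniform exponent turns the union of kernels into the kernel of one linear map.\<close>

lemma fitting_null_eq:
  assumes "length x = n - 1"
  shows "fitting_null x = {v. (R x ^^ dimension) v = 0}"
  using nilpotent_funpow_dim[OF linear_R[OF assms] _ order_refl] by (auto simp: fitting_null_def)

lemma subspace_fitting_null:
  assumes "length x = n - 1"
  shows "subspace (fitting_null x)"
  using linear_funpow[OF linear_R[OF assms], of dimension] module_hom.subspace_kernel
  unfolding fitting_null_eq[OF assms] linear_iff_module_hom by blast

lemma R_in_fitting_nullD: "R x v \<in> fitting_null x \<Longrightarrow> v \<in> fitting_null x"
  unfolding fitting_null_def by (auto simp: funpow_swap1[symmetric] intro: exI[of _ "Suc _"])

text \<open>\<open>R x\<close> is a derivation, so \<open>R x (br xs)\<close> is a sum of brackets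
  with smaller total nilpotency degree. By induction it lies in the null-component, and then so does
  \<open>br xs\<close>.\<close>

lemma subalgebra_fitting_null:
  assumes x: "length x = n - 1"
  shows "subalgebra (fitting_null x)"
  unfolding subalgebra_def
proof (intro conjI allI impI subspace_fitting_null x)
  fix xs assume xs: "length xs = n \<and> set xs \<subseteq> fitting_null x"
  define l where "l v = (LEAST i. (R x ^^ i) v = 0)" for v
  have l: "(R x ^^ l v) v = 0" if "v \<in> fitting_null x" for v
    using that unfolding l_def fitting_null_def by (auto intro: LeastI)
  have l_less: "R x v \<in> fitting_null x \<and> l (R x v) < l v" if v: "v \<in> fitting_null x" "v \<noteq> 0" for v
  proof -
    obtain j where j: "l v = Suc j" using l[OF v(1)] v(2) by (cases "l v") auto
    then have "(R x ^^ j) (R x v) = 0" using l[OF v(1)] by (simp add: funpow_swap1)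
    then show ?thesis
      unfolding j using Least_le[of "\<lambda>i. (R x ^^ i) (R x v) = 0" j]
      by (auto simp: l_def[of "R x v"] fitting_null_def)
  qed
  have "length xs = n \<and> set xs \<subseteq> fitting_null x \<longrightarrow> br xs \<in> fitting_null x"
  proof (rule list_update_less_induct[of l _ xs], intro impI)
    fix c assume IH: "\<And>i v. i < length c \<Longrightarrow> l v < l (c ! i) \<Longrightarrow>
        length (c[i := v]) = n \<and> set (c[i := v]) \<subseteq> fitting_null x \<longrightarrow> br (c[i := v]) \<in> fitting_null x"
      and c: "length c = n \<and> set c \<subseteq> fitting_null x"
    show "br c \<in> fitting_null x"
    \<comment> \<open>The degree of a zero entry cannot drop, but such an entry makes the bracket
      vanish.\<close>
    proof (cases "\<exists>i<n. c ! i = 0")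
      case True
      then show ?thesis
        using br_eq_0 c subspace_0[OF subspace_fitting_null[OF x]] by auto
    next
      case False
      have "br (c[i := R x (c ! i)]) \<in> fitting_null x" if "i < n" for i
      proof -
        have "c ! i \<in> fitting_null x" "c ! i \<noteq> 0" using that c False nth_mem by blast+
        from l_less[OF this] show ?thesis
          using IH[of i "R x (c ! i)"] c that set_update_subset_insert[of c i "R x (c ! i)"] by auto
      qed
      then have "R x (br c) \<in> fitting_null x"
        using R_br[of c x] c x by (auto intro!: subspace_sum subspace_fitting_null)
      then show ?thesis by (rule R_in_fitting_nullD)
    qed
  qed
  then show "br xs \<in> fitting_null x" using xs by (rule mp)
qed

section \<open>An Engel theorem for right multiplications\<close>

lemma series1_eq_prod_series:
  "series1 C k = prod_series {R c | c. length c = n - 1 \<and> set c \<subseteq> C} C k"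
proof (induction k)
  case (Suc k)
  have "{br (a # cs) |a cs. a \<in> series1 C k \<and> length cs = n - 1 \<and> set cs \<subseteq> C}
      = {h v |h v. h \<in> {R c | c. length c = n - 1 \<and> set c \<subseteq> C} \<and> v \<in> series1 C k}"
    (is "?L = ?R")
  proof (intro set_eqI iffI)
    fix x assume "x \<in> ?L"
    then obtain a cs where "x = R cs a" "a \<in> series1 C k" "length cs = n - 1" "set cs \<subseteq> C"
      unfolding R_def by blast
    then show "x \<in> ?R" by blast
  next
    fix x assume "x \<in> ?R"
    then show "x \<in> ?L" unfolding R_def by blast
  qed
  then show ?case by (simp only: series1.simps prod_series.simps bracket_span_def Suc)
qed simp

text \<open>The set of operators \<open>R c\<close> is not closed under commutators when \<open>n > 2\<close>, and its span need not
  consist of evidently nilpotent operators, so Jacobson's theorem on weakly closed sets does not apply.\<close>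

theorem engel:
  assumes C: "subalgebra C"
    and nil: "\<And>c v. length c = n - 1 \<Longrightarrow> set c \<subseteq> C \<Longrightarrow> v \<in> C \<Longrightarrow> \<exists>m. (R c ^^ m) v = 0"
  shows "one_nilpotent C"
proof -
  define S where "S = {R c | c. length c = n - 1 \<and> set c \<subseteq> C}"
  define d where "d = dim C"
  define \<A> where "\<A> = {H. H \<subseteq> S \<and> prod_series H C d \<subseteq> {0}}"
  have subC: "subspace C" using C by (simp add: subalgebra_def)
  have S_inv: "h v \<in> C" if "h \<in> S" "v \<in> C" for h v
    using that C R_in_subalgebra unfolding S_def by blast
  \<comment> \<open>The dimension bound converts vanishing at any index \<open>k\<close> into
    vanishing at \<open>d\<close>.\<close>
  have \<A>I: "H \<in> \<A>" if "H \<subseteq> S" "prod_series H C k \<subseteq> {0}" for H k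
    using that prod_series_dim[of C H k] subC S_inv unfolding \<A>_def d_def by blast
  have "{} \<in> \<A>" by (rule \<A>I[of _ 1]) auto
  moreover have "\<Union>\<C> \<in> \<A>" if "\<C> \<noteq> {}" "subset.chain \<A> \<C>" for \<C>
  proof -
    have "\<C> \<subseteq> \<A>" using that by (simp add: subset_chain_def)
    moreover have "prod_series (\<Union>\<C>) C d \<subseteq> {0}"
    proof
      fix v assume "v \<in> prod_series (\<Union>\<C>) C d"
      from prod_series_chain_Union[OF subC that this]
      obtain H where "H \<in> \<C>" "v \<in> prod_series H C d" by (elim bexE)
      with \<open>\<C> \<subseteq> \<A>\<close> show "v \<in> {0}" unfolding \<A>_def by blast
    qed
    ultimately show ?thesis unfolding \<A>_def by blast
  qed
  ultimately obtain H where H: "H \<in> \<A>" and max: "\<And>X. X \<in> \<A> \<Longrightarrow> H \<subseteq> X \<Longrightarrow> X = H"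
    using subset_Zorn_nonempty[of \<A>] by blast
  have HS: "H \<subseteq> S" and Hd: "prod_series H C d \<subseteq> {0}" using H by (auto simp: \<A>_def)
  \<comment> \<open>If commutators with \<open>H\<close> stay in the span of \<open>H\<close> at
    each vector, adjoining \<open>R c\<close> keeps the action nilpotent, and maximality
    applies.\<close>
  have inH: "R c \<in> H"
    if c: "length c = n - 1" "set c \<subseteq> C"
      and comm: "\<And>h v. h \<in> H \<Longrightarrow> v \<in> C \<Longrightarrow> R c (h v) - h (R c v) \<in> span {h' v | h'. h' \<in> H}"
    for c
  proof -
    have RS: "R c \<in> S" using c unfolding S_def by blast
    have "(R c ^^ dimension) v = 0" if "v \<in> C" for v
      using nil[OF c that] nilpotent_funpow_dim[OF linear_R[OF c(1)] _ order_refl] by blast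
    then obtain j where "prod_series (insert (R c) H) C j \<subseteq> prod_series H C d"
      using prod_series_insert[OF subC _ linear_R[OF c(1)] _ comm, of dimension d] S_inv HS RS
      by blast
    then have "insert (R c) H \<in> \<A>" using Hd HS RS by (intro \<A>I[of _ j]) auto
    then show ?thesis using max by blast
  qed
  \<comment> \<open>Levels count from the bottom of the flag: on \<open>C\<close>, level 0 means
    zero, \<open>d\<close> is the maximum, and operators of \<open>H\<close> strictly lower the
    level of nonzero vectors.\<close>
  define l where "l v = (LEAST j. v \<in> prod_series H C (d - j))" for v
  have l: "v \<in> prod_series H C (d - l v)" if "v \<in> C" for v
    unfolding l_def by (rule LeastI[of _ d]) (use that in simp)
  have l_less: "l (h v) < l v" if "h \<in> H" "v \<in> C" "v \<noteq> 0" for h v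
  proof -
    have "l v \<noteq> 0" using l[OF that(2)] Hd that(3) by (metis diff_zero singletonD subsetD)
    moreover have "l v \<le> d" unfolding l_def by (rule Least_le) (use that in simp)
    \<comment> \<open>Truncated subtraction makes both \<open>l v \<noteq> 0\<close> and
      \<open>l v \<le> d\<close> necessary here.\<close>
    ultimately have "d - (l v - 1) = Suc (d - l v)" by simp
    then have "h v \<in> prod_series H C (d - (l v - 1))"
      using prod_series_SucI[OF that(1) l[OF that(2)]] by (simp only:)
    then have "l (h v) \<le> l v - 1" unfolding l_def[of "h v"] by (rule Least_le)
    then show ?thesis using \<open>l v \<noteq> 0\<close> by simp
  qed
  have all: "length c = n - 1 \<and> set c \<subseteq> C \<longrightarrow> R c \<in> H" for c
  proof (rule list_update_less_induct[of l _ c], intro impI)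
    fix c assume IH: "\<And>i v. i < length c \<Longrightarrow> l v < l (c ! i) \<Longrightarrow>
        length (c[i := v]) = n - 1 \<and> set (c[i := v]) \<subseteq> C \<longrightarrow> R (c[i := v]) \<in> H"
      and "length c = n - 1 \<and> set c \<subseteq> C"
    then have c: "length c = n - 1" "set c \<subseteq> C" by auto
    show "R c \<in> H"
    proof (rule inH[OF c])
      fix h v assume h: "h \<in> H" and v: "v \<in> C"
      obtain h' where h': "h = R h'" "length h' = n - 1" using h HS unfolding S_def by blast
      have "R (c[i := h (c ! i)]) v \<in> span {h' v | h'. h' \<in> H}" if i: "i < n - 1" for i
      \<comment> \<open>A zero entry is outside the induction hypothesis, but it gives the zero
        operator. Its index is \<open>Suc i\<close> in the bracket because \<open>v\<close> takes
        slot 0.\<close>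
      proof (cases "c ! i = 0")
        case True
        then have "h (c ! i) = 0" using module_hom.zero[OF hom_R[OF h'(2)]] h'(1) by simp
        then have "R (c[i := h (c ! i)]) v = 0"
          unfolding R_def using c i by (intro br_eq_0[of _ "Suc i"]) auto
        then show ?thesis using span_zero by simp
      next
        case False
        have ci: "c ! i \<in> C" using c i nth_mem by force
        then have "set (c[i := h (c ! i)]) \<subseteq> C"
          using c S_inv h HS set_update_subset_insert[of c i "h (c ! i)"] by blast
        then have "R (c[i := h (c ! i)]) \<in> H"
          using IH[of i "h (c ! i)"] l_less[OF h ci False] c i by simp
        then show ?thesis by (intro span_base) blast
      qed
      then have "- (\<Sum>i<n - 1. R (c[i := h (c ! i)]) v) \<in> span {h' v | h'. h' \<in> H}"
        by (intro span_neg span_sum) auto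
      then show "R c (h v) - h (R c v) \<in> span {h' v | h'. h' \<in> H}"
        using R_R[OF h'(2) c(1), of v] by (simp add: h'(1))
    qed
  qed
  then have "H = S" using HS unfolding S_def by blast
  then have "series1 C d \<subseteq> {0}" using Hd by (simp add: series1_eq_prod_series S_def)
  moreover have "0 \<in> series1 C d"
    unfolding series1_eq_prod_series by (intro subspace_0 subspace_prod_series subC)
  ultimately show ?thesis unfolding one_nilpotent_def by blast
qed

section \<open>Polynomial dependence of brackets\<close>

text \<open>The first \<open>k\<close> slots vary and the rest are fixed. Rule induction on the last
  varying entry moves constants to the fixed part and pulls out sums and factors \<open>t\<close> by
  linearity.\<close>

lemma polymap_br:
  assumes "length fs = n" "\<And>f. f \<in> set fs \<Longrightarrow> polymap f"
  shows "polymap (\<lambda>t. br (map (\<lambda>f. f t) fs))"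
proof -
  have "polymap (\<lambda>t. br (map (\<lambda>f. f t) (take k fs) @ ys))"
    if "k + length ys = n" for k ys
    using that
  proof (induction k arbitrary: ys)
    case 0
    then show ?case by (simp add: polymap.const)
  next
    case (Suc k)
    have k: "k < length fs" using Suc.prems assms(1) by simp
    define X where "X t v = br (map (\<lambda>f. f t) (take k fs) @ v # ys)" for t v
    have hom: "module_hom scale scale (X t)" for t
      using br_update_hom[of "map (\<lambda>f. f t) (take k fs) @ 0 # ys" k] Suc.prems k
      by (simp add: X_def[abs_def] list_update_append)
    have "polymap (fs ! k)" using assms(2) k by simp
    then have "polymap (\<lambda>t. X t ((fs ! k) t))"
    proof induction
      case (const a)
      show ?case unfolding X_def by (rule Suc.IH) (use Suc.prems in simp)
    next
      case (add f g)
      then show ?case by (simp add: module_hom.add[OF hom] polymap.add)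
    next
      case (scale f)
      then show ?case by (simp add: module_hom.scale[OF hom] polymap.scale)
    qed
    then show ?case using k by (simp add: X_def take_Suc_conv_app_nth)
  qed
  from this[of n "[]"] show ?thesis using assms(1) by simp
qed

lemma polymap_R_funpow:
  assumes "length gs = n - 1" "\<And>g. g \<in> set gs \<Longrightarrow> polymap g"
  shows "polymap (\<lambda>t. (R (map (\<lambda>g. g t) gs) ^^ k) v)"
proof (induction k)
  case 0
  then show ?case by (simp add: polymap.const)
next
  case (Suc k)
  define F where "F t = (R (map (\<lambda>g. g t) gs) ^^ k) v" for t
  have "polymap (\<lambda>t. br (map (\<lambda>f. f t) (F # gs)))"
    using Suc assms n_pos by (intro polymap_br) (auto simp: F_def[abs_def])
  also have "(\<lambda>t. br (map (\<lambda>f. f t) (F # gs))) = (\<lambda>t. (R (map (\<lambda>g. g t) gs) ^^ Suc k) v)"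
    by (simp add: F_def R_def)
  finally show ?case .
qed

section \<open>Regularity and nilpotency along a line\<close>

theorem regular_nilpotent:
  assumes inf: "infinite (UNIV :: 'k set)" and reg: "regular x" and x: "set x \<subseteq> fitting_null x"
    and c: "length c = n - 1" "set c \<subseteq> fitting_null x" and v: "v \<in> fitting_null x"
  shows "(R c ^^ dimension) v = 0"
proof -
  let ?L0 = "fitting_null x"
  have lx: "length x = n - 1" using reg by (simp add: regular_def)
  note sub = subspace_fitting_null[OF lx]
  \<comment> \<open>The entries of the line from \<open>x\<close> at \<open>t = 0\<close> to
    \<open>c\<close> at \<open>t = 1\<close>, as functions of \<open>t\<close>.\<close>
  define gs where "gs = map2 (\<lambda>a b t. a + scale t (b - a)) x c"
  define y where "y t = map (\<lambda>g. g t) gs" for t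
  have gs: "polymap g" if "g \<in> set gs" for g
    using that by (auto simp: gs_def intro!: polymap.intros)
  have lgs: "length gs = n - 1" using lx c by (simp add: gs_def)
  have y: "length (y t) = n - 1" for t using lgs by (simp add: y_def)
  have y0: "y 0 = x" and y1: "y 1 = c"
    using lx c by (auto simp: y_def gs_def intro!: nth_equalityI)
  have y_L0: "set (y t) \<subseteq> ?L0" for t
  proof
    fix u assume "u \<in> set (y t)"
    then obtain i where i: "i < n - 1" "u = x ! i + scale t (c ! i - x ! i)"
      using lx c(1) y by (auto simp: in_set_conv_nth y_def gs_def)
    then have "x ! i \<in> ?L0" "c ! i \<in> ?L0" using x c lx nth_mem by (metis subsetD)+
    then show "u \<in> ?L0"
      unfolding i(2) by (intro subspace_add[OF sub] subspace_scale[OF sub] subspace_diff[OF sub])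
  qed
  have poly: "polymap (\<lambda>t. (R (y t) ^^ k) u)" for k u
    unfolding y_def using lgs gs by (rule polymap_R_funpow)
  have "finite {t. \<exists>v. R (y t) v \<in> ?L0 \<and> v \<notin> ?L0}"
  proof (rule finite_polymap_singular_mod[OF sub, of _ 0])
    show "polymap (\<lambda>t. R (y t) u)" for u using poly[of 1] by simp
    show "R (y 0) v \<in> ?L0 \<Longrightarrow> v \<in> ?L0" for v unfolding y0 by (rule R_in_fitting_nullD)
    show "u \<in> ?L0 \<Longrightarrow> R (y t) u \<in> ?L0" for t u
      by (rule R_in_subalgebra[OF subalgebra_fitting_null[OF lx] y y_L0])
  qed (rule linear_R[OF y])
  then have "infinite (- {t. \<exists>v. R (y t) v \<in> ?L0 \<and> v \<notin> ?L0})"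
    using inf by (simp add: finite_compl)
  moreover have "(R (y t) ^^ dimension) v = 0" if t: "\<And>v. R (y t) v \<in> ?L0 \<Longrightarrow> v \<in> ?L0" for t
  proof -
    \<comment> \<open>A vector killed by a power of \<open>R (y t)\<close> is pulled back into
      \<open>?L0\<close> one application at a time.\<close>
    have "u \<in> ?L0" if "(R (y t) ^^ i) u = 0" for i u
      using that
    proof (induction i arbitrary: u)
      case 0
      then show ?case using subspace_0[OF sub] by simp
    next
      case (Suc i)
      then show ?case using t by (simp add: funpow_swap1)
    qed
    then have "fitting_null (y t) \<subseteq> ?L0" unfolding fitting_null_def[of "y t"] by blast
    \<comment> \<open>Minimality of the dimension at \<open>x\<close> turns the inclusion just shown
      into equality.\<close>
    moreover have "dim ?L0 \<le> dim (fitting_null (y t))" using reg y by (simp add: regular_def)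
    ultimately have "fitting_null (y t) = ?L0"
      using subspace_dim_equal[OF subspace_fitting_null[OF y] sub] by blast
    then show ?thesis using v fitting_null_eq[OF y] by blast
  qed
  then have "- {t. \<exists>v. R (y t) v \<in> ?L0 \<and> v \<notin> ?L0} \<subseteq> {t. (R (y t) ^^ dimension) v = 0}" by blast
  ultimately have "infinite {t. (R (y t) ^^ dimension) v = 0}" using finite_subset by blast
  from polymap_eq_0[OF poly this, of 1] show ?thesis unfolding y1 .
qed

theorem cartan_fitting_null:
  assumes "infinite (UNIV :: 'k set)" "regular x" "set x \<subseteq> fitting_null x"
  shows "cartan_subalgebra (fitting_null x)"
proof -
  have lx: "length x = n - 1" using assms by (simp add: regular_def)
  note L0 = subalgebra_fitting_null[OF lx]
  have "one_nilpotent (fitting_null x)"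
    using regular_nilpotent[OF assms] by (intro engel L0) blast
  moreover have "fitting_null x \<subseteq> N1 (fitting_null x)"
    using R_in_subalgebra[OF L0] unfolding N1_def R_def by blast
  \<comment> \<open>The tuple \<open>x\<close> itself has its entries in the null-component, so
    \<open>a \<in> N1 (fitting_null x)\<close> gives \<open>R x a \<in> fitting_null x\<close>,
    hence \<open>a \<in> fitting_null x\<close>.\<close>
  moreover have "N1 (fitting_null x) \<subseteq> fitting_null x"
    using R_in_fitting_nullD lx assms(3) unfolding N1_def R_def by blast
  ultimately show ?thesis using L0 unfolding cartan_subalgebra_def by blast
qed

end

theorem proposition5p4:
  fixes scale :: "'k::field \<Rightarrow> 'v::ab_group_add \<Rightarrow> 'v"
    and n :: nat
    and br :: "'v list \<Rightarrow> 'v"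
    and x :: "'v list"
  assumes "leibniz_n_algebra scale n br"
    and "\<exists>B. finite B \<and> module.span scale B = UNIV"
    and "infinite (UNIV :: 'k set)"
    and "leibniz_n_algebra.regular scale n br x"
    and "set x \<subseteq> leibniz_n_algebra.fitting_null br x"
  shows "leibniz_n_algebra.cartan_subalgebra scale n br (leibniz_n_algebra.fitting_null br x)"
proof -
  interpret leibniz_n_algebra scale n br by fact
  obtain B where "finite B" "span B = UNIV" using assms(2) by blast
  \<comment> \<open>A maximal independent subset of the finite spanning set serves as the
    basis.\<close>
  then obtain Basis where "finite Basis" "independent Basis" "span Basis = UNIV"
    using maximal_independent_subset[of B] by (metis finite_subset span_mono span_span top.extremum_uniqueI)
  then interpret finite_dim_leibniz scale n br Basis by unfold_locales
  show ?thesis using assms(3-5) by (rule cartan_fitting_null)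
qed

end
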